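(* Let $(C,\phi,F)$ be a semicoherent $n$-component system with $C=\{1,\ldots,n\}$ whose component lifetimes $T_1,\ldots,T_n$ have no ties. Assume that $$q_j(A)=\frac{1}{n\binom{n-1}{|A|}}\qquad\text{for all } j\in C \text{ and all } A\subseteq C\setminus\{j\}.$$ Then for every nonempty set $M\subseteq C$ with $m=|M|$ and every $k\in\{1,\ldots,m\}$, the probability $s_M^{(k)}=\Pr(T_C=T_{k:M})$ satisfies $$ s_M^{(k)} = \sum_{A\subseteq C,\ |M\setminus A|=k}\frac{1}{n\binom{n-1}{|A|}}\sum_{j\in M\setminus A}\Delta_j\phi(A) = \sum_{j\in M}\ \sum_{A\subseteq C\setminus\{j\},\ |M\setminus A|=k}\frac{1}{n\binom{n-1}{|A|}}\,\Delta_j\phi(A), $$ $$ s_M^{(k)} = \sum_{j\in M}\ \sum_{A\subseteq C,\ |(M\setminus A)\cup\{j\}|=k} (-1)^{|\{j\}\setminus A|}\, \frac{1}{n\binom{n-1}{|A\setminus\{j\}|}}\,\phi(A), $$ and $$ s_M^{(k)} = \sum_{A\subseteq C,\ |M\cap A|=m-k+1} \frac{m-k+1}{n\binom{n-1}{|A|-1}}\,\phi(A)-\sum_{A\subseteq C,\ |M\cap A|=m-k} \frac{k}{n\binom{n-1}{|A|}}\,\phi(A). $$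
   Context: $C=\{1,\ldots,n\}$ is the set of components. $T_1,\ldots,T_n$ are nonnegative real random variables on a common probability space (the component lifetimes), with joint c.d.f. $F$, and there are no ties: $\Pr(T_i=T_j)=0$ for all distinct $i,j\in C$. The structure function $\phi\colon\{0,1\}^n\to\{0,1\}$ is identified with a set function $\phi\colon 2^C\to\{0,1\}$ (identify $(x_1,\ldots,x_n)$ with $A=\{i: x_i=1\}$). The system is semicoherent: $\phi$ is nondecreasing in each variable, $\phi(\varnothing)=0$ and $\phi(C)=1$. The system lifetime is $T_C=\max_{A\subseteq C,\ \phi(A)=1}\min_{i\in A}T_i$. For nonempty $M\subseteq C$ with $m=|M|$, $T_{k:M}$ is the $k$th smallest of the variables $T_i$, $i\in M$ ($k$th order statistic). For $j\in C$ and $A\subseteq C\setminus\{j\}$: $\Delta_j\phi(A)=\phi(A\cup\{j\})-\phi(A)$ and $q_j(A)=\Pr\big(\max_{i\in C\setminus A}T_i=T_j<\min_{i\in A}T_i\big)$. The minimum over the empty set is $+\infty$. *)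

theory Defs
  imports "HOL-Probability.Probability"
begin

text \<open>
  A structure function is given as a set function: a 0-1 state vector is identified with the set
  of components in state 1. Only its values on subsets of the component set \<open>C\<close> matter.
\<close>

definition semicoherent :: "'c set \<Rightarrow> ('c set \<Rightarrow> nat) \<Rightarrow> bool" where
  "semicoherent C \<phi> \<longleftrightarrow>
     (\<forall>A\<subseteq>C. \<phi> A \<in> {0, 1}) \<and>
     (\<forall>j\<in>C. \<forall>A\<subseteq>C - {j}. \<phi> A \<le> \<phi> (A \<union> {j})) \<and>
     \<phi> {} = 0 \<and> \<phi> C = 1"

definition discrete_derivative :: "'c \<Rightarrow> ('c set \<Rightarrow> nat) \<Rightarrow> 'c set \<Rightarrow> real" where
  "discrete_derivative j \<phi> A = real (\<phi> (A \<union> {j})) - real (\<phi> A)"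

text \<open>
  For semicoherent \<open>\<phi>\<close> and finite \<open>C\<close>, the maximum ranges over a nonempty finite family of nonempty
  finite sets, so no convention for extrema of empty sets is involved.
\<close>

definition system_lifetime :: "'c set \<Rightarrow> ('c set \<Rightarrow> nat) \<Rightarrow> ('c \<Rightarrow> real) \<Rightarrow> real" where
  "system_lifetime C \<phi> t = Max ((\<lambda>A. Min (t ` A)) ` {A. A \<subseteq> C \<and> \<phi> A = 1})"

text \<open>
  The \<open>k\<close>th smallest of the \<open>t i\<close>, \<open>i \<in> M\<close>, counted with multiplicity; meaningful for
  \<open>1 \<le> k \<le> card M\<close>.
\<close>

definition order_statistic :: "nat \<Rightarrow> 'c set \<Rightarrow> ('c \<Rightarrow> real) \<Rightarrow> real" where
  "order_statistic k M t = sorted_list_of_multiset (image_mset t (mset_set M)) ! (k - 1)"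

text \<open>
  The minimum over \<open>A\<close> is taken in the extended reals, so that it is \<open>\<infinity>\<close> for empty \<open>A\<close>.
\<close>

definition last_failure_prob ::
    "'a measure \<Rightarrow> 'c set \<Rightarrow> ('c \<Rightarrow> 'a \<Rightarrow> real) \<Rightarrow> 'c \<Rightarrow> 'c set \<Rightarrow> real" where
  "last_failure_prob P C T j A =
     measure P {\<omega> \<in> space P. Max ((\<lambda>i. T i \<omega>) ` (C - A)) = T j \<omega> \<and>
                              ereal (T j \<omega>) < (INF i\<in>A. ereal (T i \<omega>))}"

definition subsignature ::
    "'a measure \<Rightarrow> 'c set \<Rightarrow> ('c set \<Rightarrow> nat) \<Rightarrow> ('c \<Rightarrow> 'a \<Rightarrow> real) \<Rightarrow> 'c set \<Rightarrow> nat \<Rightarrow> real" where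
  "subsignature P C \<phi> T M k =
     measure P {\<omega> \<in> space P. system_lifetime C \<phi> (\<lambda>i. T i \<omega>) = order_statistic k M (\<lambda>i. T i \<omega>)}"

end

theory Submission
  imports Defs
begin

text \<open>
  Fix an outcome without ties and write \<open>U j = {i \<in> C. T j < T i}\<close> for the components that outlive
  component \<open>j\<close>. When \<open>j\<close> fails, the set of working components drops from \<open>U j \<union> {j}\<close> to \<open>U j\<close>, so
  the system dies with \<open>j\<close> iff \<open>\<Delta>\<^sub>j\<phi>(U j) = 1\<close>. For \<open>j \<in> M\<close>, the lifetime \<open>T j\<close> has rank
  \<open>|M \<setminus> U j|\<close> among those of \<open>M\<close>, so \<open>T j\<close> is the \<open>k\<close>th order statistic iff \<open>|M \<setminus> U j| = k\<close>. Finally,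
  the event whose probability is \<open>q\<^sub>j(A)\<close> is just \<open>U j = A\<close>. Hence, almost surely,
  the indicator of \<open>T\<^sub>C = T\<^sub>k\<^sub>:\<^sub>M\<close> is the sum of \<open>\<Delta>\<^sub>j\<phi>(A) \<cdot> [U j = A]\<close> over \<open>j \<in> M\<close> and the sets
  \<open>A \<subseteq> C \<setminus> {j}\<close> with \<open>|M \<setminus> A| = k\<close> (lemma \<open>indicator_lifetime_eq_order_statistic\<close>).
  Integration turns this into a formula valid for every joint distribution without ties, with \<open>q\<^sub>j(A)\<close> as coefficients
  (proposition \<open>subsignature_eq_sum_last_failure_prob\<close>).

  Here \<open>q\<^sub>j(A)\<close> is a weight \<open>w(A)\<close> that depends on \<open>|A|\<close> only. The four
  expressions are rearrangements of one double sum: exchange the order of summation; or split \<open>\<Delta>\<^sub>j\<phi>(A) = \<phi>(A \<union> {j}) - \<phi>(A)\<close> and reindex the first part by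
  \<open>B = A \<union> {j}\<close>; and then, since \<open>w(B \<setminus> {j})\<close> is the same for all \<open>j \<in> B\<close>, count for each set the
  \<open>j \<in> M\<close> that contribute it, which are \<open>|M \<inter> B| = m - k + 1\<close> in the first part and
  \<open>|M \<setminus> A| = k\<close> in the second.
\<close>

section \<open>Threshold descriptions of order statistics and system lifetimes\<close>

text \<open>
  The elements satisfying a downward closed predicate form a prefix of a sorted list.
\<close>

lemma sorted_nth_downward_closed_iff:
  assumes "sorted xs" "i < length xs" "\<And>x y. x \<le> y \<Longrightarrow> Q y \<Longrightarrow> Q x"
  shows "Q (xs ! i) \<longleftrightarrow> i < length (filter Q xs)"
  using assms(1,2)
proof (induction xs arbitrary: i)
  case Nil
  then show ?case by simp
next
  case (Cons a xs)
  show ?case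
  proof (cases "Q a")
    case True
    then show ?thesis using Cons by (cases i) auto
  next
    case False
    then have "\<not> Q y" if "y \<in> set (a # xs)" for y
      using Cons.prems(1) assms(3) that by auto
    then show ?thesis
      using nth_mem[OF Cons.prems(2)] by (metis filter_False list.size(3) not_less_zero)
  qed
qed

text \<open>
  Since both versions hold for all \<open>x\<close>, together they decide when the order statistic equals \<open>x\<close>, and
  the first one also yields its measurability.
\<close>

lemma order_statistic_threshold_iff:
  assumes "finite M" "k \<in> {1..card M}"
  shows "order_statistic k M t \<le> x \<longleftrightarrow> k \<le> card {i\<in>M. t i \<le> x}"
    and "order_statistic k M t < x \<longleftrightarrow> k \<le> card {i\<in>M. t i < x}"
proof -
  let ?xs = "sorted_list_of_multiset (image_mset t (mset_set M))"
  have count: "length (filter Q ?xs) = card {i\<in>M. Q (t i)}" for Q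
  proof -
    have "length (filter Q ?xs) = size (filter_mset Q (image_mset t (mset_set M)))"
      by (metis mset_filter mset_sorted_list_of_multiset size_mset)
    also have "\<dots> = card {i\<in>M. Q (t i)}"
      using assms(1) by (simp add: filter_mset_image_mset)
    finally show ?thesis .
  qed
  have "length ?xs = card M"
    using count[of "\<lambda>_. True"] by simp
  then have "Q (order_statistic k M t) \<longleftrightarrow> k \<le> card {i\<in>M. Q (t i)}"
    if "\<And>x y. x \<le> y \<Longrightarrow> Q y \<Longrightarrow> Q x" for Q
    using sorted_nth_downward_closed_iff[of ?xs "k - 1" Q] that assms(2) count[of Q]
    unfolding order_statistic_def by force
  from this[of "\<lambda>y. y \<le> x"] this[of "\<lambda>y. y < x"]
  show "order_statistic k M t \<le> x \<longleftrightarrow> k \<le> card {i\<in>M. t i \<le> x}"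
    and "order_statistic k M t < x \<longleftrightarrow> k \<le> card {i\<in>M. t i < x}"
    by auto
qed

lemma order_statistic_in_image:
  assumes "finite M" "k \<in> {1..card M}"
  shows "order_statistic k M t \<in> t ` M"
proof -
  let ?x = "order_statistic k M t"
  have "card {i\<in>M. t i < ?x} < card {i\<in>M. t i \<le> ?x}"
    using order_statistic_threshold_iff[OF assms, of t ?x] by linarith
  then have "{i\<in>M. t i < ?x} \<noteq> {i\<in>M. t i \<le> ?x}" by force
  then show ?thesis by (force simp: less_le)
qed

text \<open>The definition gives monotonicity for one added component; larger steps are chains of these.\<close>

lemma semicoherent_mono:
  assumes "semicoherent C \<phi>" "finite C" "A \<subseteq> B" "B \<subseteq> C"
  shows "\<phi> A \<le> \<phi> B"
proof -
  have "finite B" using assms finite_subset by blast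
  then show ?thesis using assms(3,4)
  proof (induction B arbitrary: A rule: finite_psubset_induct)
    case (psubset B)
    show ?case
    proof (cases "A = B")
      case False
      then obtain j where j: "j \<in> B" "j \<notin> A" using psubset.prems by auto
      have "\<phi> A \<le> \<phi> (B - {j})" using psubset j by (intro psubset.IH) auto
      also have "\<dots> \<le> \<phi> ((B - {j}) \<union> {j})"
      proof -
        have "j \<in> C" "B - {j} \<subseteq> C - {j}" using j psubset.prems by auto
        then show ?thesis using assms(1) by (simp only: semicoherent_def)
      qed
      also have "(B - {j}) \<union> {j} = B" using j by auto
      finally show ?thesis .
    qed simp
  qed
qed

lemma semicoherent_bool: "semicoherent C \<phi> \<Longrightarrow> A \<subseteq> C \<Longrightarrow> \<phi> A = 0 \<or> \<phi> A = 1"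
  unfolding semicoherent_def by blast

text \<open>
  The system survives time \<open>x\<close> iff the components that survive it keep it working: by
  monotonicity of \<open>\<phi>\<close>, some working set consists of survivors iff the set of all survivors works.
\<close>

lemma system_lifetime_threshold_iff:
  assumes "semicoherent C \<phi>" "finite C"
  shows "x \<le> system_lifetime C \<phi> t \<longleftrightarrow> \<phi> {i\<in>C. x \<le> t i} = 1"
    and "x < system_lifetime C \<phi> t \<longleftrightarrow> \<phi> {i\<in>C. x < t i} = 1"
proof -
  let ?W = "{A. A \<subseteq> C \<and> \<phi> A = 1}"
  have W: "finite ?W" "C \<in> ?W" "?W \<noteq> {}" and e: "\<phi> {} = 0"
    using assms by (auto simp: semicoherent_def)
  have fin: "finite A" "A \<noteq> {}" if "A \<in> ?W" for A
    using that assms(2) e by (auto intro: finite_subset)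
  have up: "\<phi> B = 1" if "A \<in> ?W" "A \<subseteq> B" "B \<subseteq> C" for A B
    using semicoherent_mono[OF assms that(2,3)] semicoherent_bool[OF assms(1) that(3)] that(1) by auto
  have "x \<le> system_lifetime C \<phi> t \<longleftrightarrow> (\<exists>A\<in>?W. \<forall>i\<in>A. x \<le> t i)"
    unfolding system_lifetime_def using W fin by (subst Max_ge_iff) auto
  also have "\<dots> \<longleftrightarrow> \<phi> {i\<in>C. x \<le> t i} = 1"
  proof
    assume "\<exists>A\<in>?W. \<forall>i\<in>A. x \<le> t i"
    then obtain A where "A \<in> ?W" "\<forall>i\<in>A. x \<le> t i" by blast
    then show "\<phi> {i\<in>C. x \<le> t i} = 1" by (intro up[of A]) auto
  qed (auto intro!: exI[of _ "{i\<in>C. x \<le> t i}"])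
  finally show "x \<le> system_lifetime C \<phi> t \<longleftrightarrow> \<phi> {i\<in>C. x \<le> t i} = 1" .
  have "x < system_lifetime C \<phi> t \<longleftrightarrow> (\<exists>A\<in>?W. \<forall>i\<in>A. x < t i)"
    unfolding system_lifetime_def using W fin by (subst Max_gr_iff) auto
  also have "\<dots> \<longleftrightarrow> \<phi> {i\<in>C. x < t i} = 1"
  proof
    assume "\<exists>A\<in>?W. \<forall>i\<in>A. x < t i"
    then obtain A where "A \<in> ?W" "\<forall>i\<in>A. x < t i" by blast
    then show "\<phi> {i\<in>C. x < t i} = 1" by (intro up[of A]) auto
  qed (auto intro!: exI[of _ "{i\<in>C. x < t i}"])
  finally show "x < system_lifetime C \<phi> t \<longleftrightarrow> \<phi> {i\<in>C. x < t i} = 1" .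
qed

section \<open>The outcome without ties\<close>

text \<open>
  The two thresholds at \<open>t j\<close> say that \<open>system_lifetime C \<phi> t = t j\<close> iff \<open>\<phi>\<close> is 1 on the components
  that live at least as long as \<open>j\<close> and 0 on those that outlive \<open>j\<close>. Without ties these sets differ
  only by \<open>j\<close>.
\<close>

lemma indicator_lifetime_eq_component:
  assumes "semicoherent C \<phi>" "finite C" "inj_on t C" "j \<in> C"
  shows "discrete_derivative j \<phi> {i\<in>C. t j < t i} = of_bool (system_lifetime C \<phi> t = t j)"
proof -
  let ?U = "{i\<in>C. t j < t i}" and ?V = "{i\<in>C. t j \<le> t i}"
  have V: "?U \<union> {j} = ?V"
    using assms(3,4) by (auto simp: less_le dest: inj_onD)
  have "\<phi> ?U \<le> \<phi> ?V" by (rule semicoherent_mono[OF assms(1,2)]) auto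
  moreover have "\<phi> ?U = 0 \<or> \<phi> ?U = 1" by (rule semicoherent_bool[OF assms(1)]) auto
  moreover have "\<phi> ?V = 0 \<or> \<phi> ?V = 1" by (rule semicoherent_bool[OF assms(1)]) auto
  moreover have "system_lifetime C \<phi> t = t j \<longleftrightarrow> \<phi> ?V = 1 \<and> \<phi> ?U \<noteq> 1"
    using system_lifetime_threshold_iff[OF assms(1,2), of "t j" t] by auto
  ultimately show ?thesis
    unfolding discrete_derivative_def V by auto
qed

text \<open>
  Without ties, the number of members of \<open>M\<close> that do not outlive \<open>j\<close> is the rank of \<open>t j\<close> in \<open>M\<close>.
\<close>

lemma order_statistic_eq_component_iff:
  assumes "finite C" "M \<subseteq> C" "inj_on t C" "j \<in> M" "k \<in> {1..card M}"
  shows "order_statistic k M t = t j \<longleftrightarrow> card (M - {i\<in>C. t j < t i}) = k"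
proof -
  have fin: "finite M" using assms(1,2) finite_subset by blast
  have "{i\<in>M. t i \<le> t j} = insert j {i\<in>M. t i < t j}"
    using assms(2-4) by (auto simp: less_le dest: inj_onD)
  then have "card {i\<in>M. t i \<le> t j} = Suc (card {i\<in>M. t i < t j})"
    using fin by simp
  moreover have "M - {i\<in>C. t j < t i} = {i\<in>M. t i \<le> t j}"
    using assms(2) by auto
  ultimately have "order_statistic k M t \<le> t j \<longleftrightarrow> k \<le> card (M - {i\<in>C. t j < t i})"
      "order_statistic k M t < t j \<longleftrightarrow> k < card (M - {i\<in>C. t j < t i})"
    by (simp_all add: order_statistic_threshold_iff[OF fin assms(5)] less_Suc_eq_le)
  then show ?thesis by fastforce
qed

text \<open>
  The first condition says that no component outside \<open>A\<close> outlives \<open>j\<close>, the second that every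
  component in \<open>A\<close> does.
\<close>

lemma last_failure_iff:
  fixes t :: "'c \<Rightarrow> real"
  assumes "finite C" "j \<in> C" "A \<subseteq> C - {j}"
  shows "Max (t ` (C - A)) = t j \<and> ereal (t j) < (INF i\<in>A. ereal (t i)) \<longleftrightarrow>
    A = {i\<in>C. t j < t i}"
proof -
  have finA: "finite A" using assms finite_subset by blast
  have "Max (t ` (C - A)) = t j \<longleftrightarrow> (\<forall>i\<in>C - A. t i \<le> t j)"
    using assms by (subst Max_eq_iff) auto
  moreover have "ereal (t j) < (INF i\<in>A. ereal (t i)) \<longleftrightarrow> (\<forall>i\<in>A. t j < t i)"
  proof (cases "A = {}")
    case False
    then have "(INF i\<in>A. ereal (t i)) = Min ((\<lambda>i. ereal (t i)) ` A)"
      using finA by (simp add: Min_Inf)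
    then show ?thesis using finA False by simp
  qed (simp add: top_ereal_def)
  moreover have "(\<forall>i\<in>C - A. t i \<le> t j) \<and> (\<forall>i\<in>A. t j < t i) \<longleftrightarrow> A = {i\<in>C. t j < t i}"
    using assms(3) by (auto simp flip: not_less)
  ultimately show ?thesis by simp
qed

text \<open>
  In the double sum only \<open>A = {i \<in> C. t j < t i}\<close> survives for each \<open>j\<close>, and then only the one \<open>j\<close>
  whose rank in \<open>M\<close> is \<open>k\<close>. The remaining term is the indicator of \<open>system_lifetime C \<phi> t = t j\<close>.
\<close>

lemma indicator_lifetime_eq_order_statistic:
  fixes t :: "'c \<Rightarrow> real"
  assumes "semicoherent C \<phi>" "finite C" "inj_on t C" "M \<subseteq> C" "k \<in> {1..card M}"
  shows "of_bool (system_lifetime C \<phi> t = order_statistic k M t) =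
    (\<Sum>j\<in>M. \<Sum>A | A \<subseteq> C - {j} \<and> card (M - A) = k.
       discrete_derivative j \<phi> A *
         of_bool (Max (t ` (C - A)) = t j \<and> ereal (t j) < (INF i\<in>A. ereal (t i))))"
    (is "_ = (\<Sum>j\<in>M. ?S j)")
proof -
  have finM: "finite M" using assms finite_subset by blast
  define U where "U j = {i\<in>C. t j < t i}" for j
  obtain l where l: "l \<in> M" "order_statistic k M t = t l"
    using order_statistic_in_image[OF finM assms(5)] by blast
  have lk: "card (M - U j) = k \<longleftrightarrow> j = l" if "j \<in> M" for j
    using order_statistic_eq_component_iff[OF assms(2,4,3) that assms(5)] l that assms(3,4)
    unfolding U_def by (auto dest: inj_onD)
  have "?S j = (if j = l then discrete_derivative l \<phi> (U l) else 0)" if j: "j \<in> M" for j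
  proof -
    have "?S j = (\<Sum>A | A \<subseteq> C - {j} \<and> card (M - A) = k.
        if A = U j then discrete_derivative j \<phi> (U j) else 0)"
    proof (intro sum.cong refl)
      fix A assume "A \<in> {A. A \<subseteq> C - {j} \<and> card (M - A) = k}"
      then have "A \<subseteq> C - {j}" "j \<in> C" using j assms(4) by auto
      from last_failure_iff[OF assms(2) this(2,1), of t]
      show "discrete_derivative j \<phi> A *
          of_bool (Max (t ` (C - A)) = t j \<and> ereal (t j) < (INF i\<in>A. ereal (t i))) =
          (if A = U j then discrete_derivative j \<phi> (U j) else 0)"
        by (simp add: U_def)
    qed
    also have "\<dots> = (if card (M - U j) = k then discrete_derivative j \<phi> (U j) else 0)"
    proof (subst sum.delta)
      show "finite {A. A \<subseteq> C - {j} \<and> card (M - A) = k}" using assms(2) by simp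
    qed (auto simp: U_def)
    finally show ?thesis using lk[OF j] by auto
  qed
  then have "(\<Sum>j\<in>M. ?S j) = discrete_derivative l \<phi> (U l)"
    using finM l(1) by simp
  also have "\<dots> = of_bool (system_lifetime C \<phi> t = order_statistic k M t)"
    using indicator_lifetime_eq_component[OF assms(1-3), of l] l assms(4)
    unfolding U_def by auto
  finally show ?thesis by simp
qed

section \<open>The subsignature of a system without ties\<close>

lemma system_lifetime_measurable:
  assumes "finite C" "semicoherent C \<phi>" "\<And>i. i \<in> C \<Longrightarrow> T i \<in> borel_measurable P"
  shows "(\<lambda>\<omega>. system_lifetime C \<phi> (\<lambda>i. T i \<omega>)) \<in> borel_measurable P"
  unfolding system_lifetime_def
proof (rule borel_measurable_Max)
  show "finite {A. A \<subseteq> C \<and> \<phi> A = 1}" using assms(1) by simp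
  show "(\<lambda>\<omega>. Min ((\<lambda>i. T i \<omega>) ` A)) \<in> borel_measurable P" if "A \<in> {A. A \<subseteq> C \<and> \<phi> A = 1}" for A
    using that assms by (intro borel_measurable_Min) (auto intro: finite_subset)
qed

lemma order_statistic_measurable:
  assumes "finite M" "k \<in> {1..card M}" "\<And>i. i \<in> M \<Longrightarrow> T i \<in> borel_measurable P"
  shows "(\<lambda>\<omega>. order_statistic k M (\<lambda>i. T i \<omega>)) \<in> borel_measurable P"
proof (rule borel_measurableI_le)
  fix x
  have card_eq: "real (card {i\<in>M. T i \<omega> \<le> x}) = (\<Sum>i\<in>M. indicator {..x} (T i \<omega>))" for \<omega>
    using assms(1) by (simp add: indicator_def sum.If_cases Int_def)
  have [measurable]: "(\<lambda>\<omega>. \<Sum>i\<in>M. indicator {..x} (T i \<omega>) :: real) \<in> borel_measurable P"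
  proof (rule borel_measurable_sum)
    fix i assume "i \<in> M"
    note [measurable] = assms(3)[OF this]
    show "(\<lambda>\<omega>. indicator {..x} (T i \<omega>) :: real) \<in> borel_measurable P" by measurable
  qed
  have "order_statistic k M (\<lambda>i. T i \<omega>) \<le> x \<longleftrightarrow> real k \<le> (\<Sum>i\<in>M. indicator {..x} (T i \<omega>))" for \<omega>
    by (simp add: order_statistic_threshold_iff[OF assms(1,2)] flip: card_eq)
  then have "{\<omega> \<in> space P. order_statistic k M (\<lambda>i. T i \<omega>) \<le> x} =
      {\<omega> \<in> space P. real k \<le> (\<Sum>i\<in>M. indicator {..x} (T i \<omega>))}"
    by (simp only:)
  also have "\<dots> \<in> sets P" by measurable
  finally show "{\<omega> \<in> space P. order_statistic k M (\<lambda>i. T i \<omega>) \<le> x} \<in> sets P" .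
qed

text \<open>
  The outcomes with a tie between two of the finitely many components form a null set, so the
  pointwise identity of indicators holds almost everywhere and can be integrated.
\<close>

proposition subsignature_eq_sum_last_failure_prob:
  fixes P :: "'a measure"
  assumes "prob_space P" "finite C" "semicoherent C \<phi>"
    and T: "\<And>i. i \<in> C \<Longrightarrow> T i \<in> borel_measurable P"
    and no_ties: "\<And>i j. i \<in> C \<Longrightarrow> j \<in> C \<Longrightarrow> i \<noteq> j \<Longrightarrow>
      measure P {\<omega> \<in> space P. T i \<omega> = T j \<omega>} = 0"
    and "M \<subseteq> C" "k \<in> {1..card M}"
  shows "subsignature P C \<phi> T M k =
    (\<Sum>j\<in>M. \<Sum>A | A \<subseteq> C - {j} \<and> card (M - A) = k.
       last_failure_prob P C T j A * discrete_derivative j \<phi> A)"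
proof -
  interpret prob_space P by fact
  have finM: "finite M" using assms(2,6) finite_subset by blast
  define E where "E j A = {\<omega> \<in> space P. Max ((\<lambda>i. T i \<omega>) ` (C - A)) = T j \<omega> \<and>
    ereal (T j \<omega>) < (INF i\<in>A. ereal (T i \<omega>))}" for j A
  define S where "S = {\<omega> \<in> space P.
    system_lifetime C \<phi> (\<lambda>i. T i \<omega>) = order_statistic k M (\<lambda>i. T i \<omega>)}"
  have E_sets: "E j A \<in> events" if "j \<in> C" "A \<subseteq> C - {j}" for j A
  proof -
    have "finite A" using assms(2) that finite_subset by blast
    moreover have [measurable]: "(\<lambda>\<omega>. Max ((\<lambda>i. T i \<omega>) ` (C - A))) \<in> borel_measurable P"
      using assms(2) T by (intro borel_measurable_Max) auto
    moreover have [measurable]: "(\<lambda>\<omega>. INF i\<in>A. ereal (T i \<omega>)) \<in> borel_measurable P"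
      using calculation(1) T that by (intro borel_measurable_INF) (auto intro: countable_finite)
    moreover note [measurable] = T[OF that(1)]
    show ?thesis unfolding E_def by measurable
  qed
  have S_sets: "S \<in> events"
  proof -
    have [measurable]: "(\<lambda>\<omega>. system_lifetime C \<phi> (\<lambda>i. T i \<omega>)) \<in> borel_measurable P"
      "(\<lambda>\<omega>. order_statistic k M (\<lambda>i. T i \<omega>)) \<in> borel_measurable P"
      using assms finM by (auto intro!: system_lifetime_measurable order_statistic_measurable)
    show ?thesis unfolding S_def by measurable
  qed
  have "AE \<omega> in P. \<forall>i\<in>C. \<forall>j\<in>C. i \<noteq> j \<longrightarrow> T i \<omega> \<noteq> T j \<omega>"
  proof (intro AE_finite_allI assms(2))
    fix i j assume ij: "i \<in> C" "j \<in> C"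
    show "AE \<omega> in P. i \<noteq> j \<longrightarrow> T i \<omega> \<noteq> T j \<omega>"
    proof (cases "i = j")
      case False
      note [measurable] = T[OF ij(1)] T[OF ij(2)]
      have "{\<omega> \<in> space P. T i \<omega> = T j \<omega>} \<in> events" by measurable
      then have "AE \<omega> in P. \<omega> \<notin> {\<omega> \<in> space P. T i \<omega> = T j \<omega>}"
        using no_ties[OF ij False] by (simp add: prob_eq_0)
      then show ?thesis by (auto elim: AE_mp)
    qed simp
  qed
  then have inj: "AE \<omega> in P. inj_on (\<lambda>i. T i \<omega>) C"
    by eventually_elim (auto simp: inj_on_def)
  have "prob S = (\<integral>\<omega>. indicator S \<omega> \<partial>P)"
    using S_sets by simp
  also have "\<dots> = (\<integral>\<omega>. (\<Sum>j\<in>M. \<Sum>A | A \<subseteq> C - {j} \<and> card (M - A) = k.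
      discrete_derivative j \<phi> A * indicator (E j A) \<omega>) \<partial>P)"
  proof (intro integral_cong_AE)
    show "AE \<omega> in P. indicator S \<omega> = (\<Sum>j\<in>M. \<Sum>A | A \<subseteq> C - {j} \<and> card (M - A) = k.
      discrete_derivative j \<phi> A * indicator (E j A) \<omega>)"
      using inj AE_space
    proof eventually_elim
      case (elim \<omega>)
      show ?case
        using indicator_lifetime_eq_order_statistic[OF assms(3,2) elim(1) assms(6,7)] elim(2)
        by (simp add: S_def E_def indicator_def of_bool_def)
    qed
    show "(\<lambda>\<omega>. \<Sum>j\<in>M. \<Sum>A | A \<subseteq> C - {j} \<and> card (M - A) = k.
      discrete_derivative j \<phi> A * indicator (E j A) \<omega>) \<in> borel_measurable P"
      using assms(6) by (intro borel_measurable_sum borel_measurable_times borel_measurable_const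
        borel_measurable_indicator E_sets) auto
  qed (use S_sets in auto)
  also have "\<dots> = (\<Sum>j\<in>M. \<Sum>A | A \<subseteq> C - {j} \<and> card (M - A) = k.
      discrete_derivative j \<phi> A * prob (E j A))"
  proof -
    have int: "integrable P (\<lambda>\<omega>. discrete_derivative j \<phi> A * indicator (E j A) \<omega>)"
      if "j \<in> M" "A \<subseteq> C - {j}" for j A
      using that assms(6) by (intro integrable_mult_right integrable_real_indicator E_sets)
        (auto simp: emeasure_eq_measure)
    have val: "(\<integral>\<omega>. discrete_derivative j \<phi> A * indicator (E j A) \<omega> \<partial>P) =
        discrete_derivative j \<phi> A * prob (E j A)" if "j \<in> M" "A \<subseteq> C - {j}" for j A
      using E_sets[of j A] that assms(6) by auto
    have "(\<integral>\<omega>. (\<Sum>j\<in>M. \<Sum>A | A \<subseteq> C - {j} \<and> card (M - A) = k.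
        discrete_derivative j \<phi> A * indicator (E j A) \<omega>) \<partial>P) =
      (\<Sum>j\<in>M. \<integral>\<omega>. (\<Sum>A | A \<subseteq> C - {j} \<and> card (M - A) = k.
        discrete_derivative j \<phi> A * indicator (E j A) \<omega>) \<partial>P)"
      by (intro Bochner_Integration.integral_sum Bochner_Integration.integrable_sum int) auto
    also have "\<dots> = (\<Sum>j\<in>M. \<Sum>A | A \<subseteq> C - {j} \<and> card (M - A) = k.
        \<integral>\<omega>. discrete_derivative j \<phi> A * indicator (E j A) \<omega> \<partial>P)"
      by (intro sum.cong refl Bochner_Integration.integral_sum int) auto
    also have "\<dots> = (\<Sum>j\<in>M. \<Sum>A | A \<subseteq> C - {j} \<and> card (M - A) = k.
        discrete_derivative j \<phi> A * prob (E j A))"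
      by (intro sum.cong refl val) auto
    finally show ?thesis .
  qed
  finally show ?thesis
    by (simp add: subsignature_def last_failure_prob_def S_def E_def mult.commute)
qed

section \<open>Rearranging weighted sums of discrete derivatives\<close>

text \<open>
  The term \<open>\<phi>(A \<union> {j})\<close> is reindexed by \<open>B = A \<union> {j}\<close>. As \<open>j \<in> M\<close>, adding \<open>j\<close> to \<open>A\<close> lowers
  \<open>|M \<setminus> A|\<close> by one.
\<close>

lemma sum_weighted_derivative_split:
  fixes w :: "'c set \<Rightarrow> real"
  assumes "finite C" "M \<subseteq> C" "j \<in> M"
  shows "(\<Sum>A | A \<subseteq> C - {j} \<and> card (M - A) = k. w A * discrete_derivative j \<phi> A) =
      (\<Sum>B | B \<subseteq> C \<and> j \<in> B \<and> card (M - B) + 1 = k. w (B - {j}) * real (\<phi> B))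
    - (\<Sum>A | A \<subseteq> C \<and> j \<notin> A \<and> card (M - A) = k. w A * real (\<phi> A))"
proof -
  have finM: "finite M" using assms finite_subset by blast
  have c: "card (M - B) + 1 = card (M - (B - {j}))" if "j \<in> B" for B
  proof -
    have "M - (B - {j}) = insert j (M - B)" using assms(3) that by auto
    then show ?thesis using finM that by simp
  qed
  have rem: "A - {j} = A" if "A \<subseteq> C - {j}" for A using that by auto
  have "(\<Sum>A | A \<subseteq> C - {j} \<and> card (M - A) = k. w A * real (\<phi> (A \<union> {j}))) =
      (\<Sum>B | B \<subseteq> C \<and> j \<in> B \<and> card (M - B) + 1 = k. w (B - {j}) * real (\<phi> B))"
    using assms
    by (intro sum.reindex_bij_witness[of _ "\<lambda>B. B - {j}" "\<lambda>A. A \<union> {j}"])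
      (auto simp: c rem insert_absorb simp flip: One_nat_def)
  moreover have "{A. A \<subseteq> C - {j} \<and> card (M - A) = k} =
      {A. A \<subseteq> C \<and> j \<notin> A \<and> card (M - A) = k}" by auto
  ultimately show ?thesis
    by (simp add: discrete_derivative_def right_diff_distrib sum_subtractf)
qed

lemma sum_weighted_double_count:
  fixes w :: "'c set \<Rightarrow> real"
  assumes "finite C" "finite M"
  shows "(\<Sum>j\<in>M. \<Sum>A | A \<subseteq> C \<and> R A j \<and> Q A. w A) =
    (\<Sum>A | A \<subseteq> C \<and> Q A. real (card {j\<in>M. R A j}) * w A)"
proof -
  have "(\<Sum>j\<in>M. \<Sum>A | A \<in> {A. A \<subseteq> C \<and> Q A} \<and> R A j. w A) =
      (\<Sum>A | A \<subseteq> C \<and> Q A. \<Sum>j | j \<in> M \<and> R A j. w A)"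
    using assms by (intro sum.swap_restrict) auto
  then show ?thesis by (simp add: conj_ac)
qed

section \<open>Weights that depend only on the number of survivors\<close>

theorem corollary10:
  fixes P :: "'a measure" and n m k :: nat and C M :: "nat set"
    and T :: "nat \<Rightarrow> 'a \<Rightarrow> real" and \<phi> :: "nat set \<Rightarrow> nat"
  assumes "prob_space P"
    and "C = {1..n}"
    and "semicoherent C \<phi>"
    and "\<And>i. i \<in> C \<Longrightarrow> T i \<in> borel_measurable P"
    and "\<And>i \<omega>. i \<in> C \<Longrightarrow> \<omega> \<in> space P \<Longrightarrow> 0 \<le> T i \<omega>"
    and "\<And>i j. i \<in> C \<Longrightarrow> j \<in> C \<Longrightarrow> i \<noteq> j \<Longrightarrow> measure P {\<omega> \<in> space P. T i \<omega> = T j \<omega>} = 0"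
    and "\<And>j A. j \<in> C \<Longrightarrow> A \<subseteq> C - {j} \<Longrightarrow>
           last_failure_prob P C T j A = 1 / (real n * real ((n - 1) choose card A))"
    and "M \<subseteq> C" and "M \<noteq> {}" and "m = card M" and "k \<in> {1..m}"
  shows "subsignature P C \<phi> T M k =
           (\<Sum>A | A \<subseteq> C \<and> card (M - A) = k.
              1 / (real n * real ((n - 1) choose card A)) *
              (\<Sum>j\<in>M - A. discrete_derivative j \<phi> A))
       \<and> subsignature P C \<phi> T M k =
           (\<Sum>j\<in>M. \<Sum>A | A \<subseteq> C - {j} \<and> card (M - A) = k.
              1 / (real n * real ((n - 1) choose card A)) * discrete_derivative j \<phi> A)
       \<and> subsignature P C \<phi> T M k =
           (\<Sum>j\<in>M. \<Sum>A | A \<subseteq> C \<and> card ((M - A) \<union> {j}) = k.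
              (- 1) ^ card ({j} - A) *
              (1 / (real n * real ((n - 1) choose card (A - {j})))) * real (\<phi> A))
       \<and> subsignature P C \<phi> T M k =
           (\<Sum>A | A \<subseteq> C \<and> card (M \<inter> A) = m - k + 1.
              (real m - real k + 1) / (real n * real ((n - 1) choose (card A - 1))) * real (\<phi> A))
         - (\<Sum>A | A \<subseteq> C \<and> card (M \<inter> A) = m - k.
              real k / (real n * real ((n - 1) choose card A)) * real (\<phi> A))"
proof -
  have C: "finite C" and M: "finite M" and k: "1 \<le> k" "k \<le> m"
    using assms(2,8,11) by (auto intro: finite_subset)
  define w where "w A = 1 / (real n * real ((n - 1) choose card A))" for A :: "nat set"
  define D where "D j A = discrete_derivative j \<phi> A" for j A
  have card_diff: "card (M - A) + card (M \<inter> A) = m" for A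
    using card_Int_Diff[OF M, of A] assms(10) by linarith
  have s2: "subsignature P C \<phi> T M k =
      (\<Sum>j\<in>M. \<Sum>A | A \<subseteq> C - {j} \<and> card (M - A) = k. w A * D j A)"
  proof -
    have "last_failure_prob P C T j A = w A" if "j \<in> M" "A \<subseteq> C - {j}" for j A
      using assms(7)[of j A] assms(8) that by (auto simp: w_def)
    then show ?thesis
      using subsignature_eq_sum_last_failure_prob[OF assms(1) C assms(3,4,6,8)] assms(10,11)
      by (simp add: D_def)
  qed
  have s1: "subsignature P C \<phi> T M k =
      (\<Sum>A | A \<subseteq> C \<and> card (M - A) = k. w A * (\<Sum>j\<in>M - A. D j A))"
  proof -
    have eq: "{A. A \<subseteq> C - {j} \<and> card (M - A) = k} =
        {A. A \<in> {A. A \<subseteq> C \<and> card (M - A) = k} \<and> j \<notin> A}" for j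
      by auto
    have "subsignature P C \<phi> T M k =
        (\<Sum>A | A \<subseteq> C \<and> card (M - A) = k. \<Sum>j | j \<in> M \<and> j \<notin> A. w A * D j A)"
      unfolding s2 eq using C M by (intro sum.swap_restrict) auto
    moreover have "{j. j \<in> M \<and> j \<notin> A} = M - A" for A by auto
    ultimately show ?thesis by (simp add: sum_distrib_left)
  qed
  have split: "subsignature P C \<phi> T M k =
      (\<Sum>j\<in>M. (\<Sum>A | A \<subseteq> C \<and> j \<in> A \<and> card (M - A) + 1 = k. w (A - {j}) * real (\<phi> A))
           - (\<Sum>A | A \<subseteq> C \<and> j \<notin> A \<and> card (M - A) = k. w A * real (\<phi> A)))"
    unfolding s2 D_def using C assms(8) by (intro sum.cong refl sum_weighted_derivative_split)
  have s3: "subsignature P C \<phi> T M k =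
      (\<Sum>j\<in>M. \<Sum>A | A \<subseteq> C \<and> card ((M - A) \<union> {j}) = k.
         (- 1) ^ card ({j} - A) * w (A - {j}) * real (\<phi> A))"
    unfolding split
  proof (intro sum.cong refl)
    fix j assume j: "j \<in> M"
    \<comment> \<open>Since \<open>j \<in> M\<close>, adding \<open>j\<close> enlarges \<open>M - A\<close> iff \<open>j \<in> A\<close>, so one cardinality condition covers
      both sums; the sign tells them apart.\<close>
    let ?f = "\<lambda>A. (- 1) ^ card ({j} - A) * w (A - {j}) * real (\<phi> A)"
    let ?X = "{A. A \<subseteq> C \<and> j \<in> A \<and> card (M - A) + 1 = k}"
    let ?Y = "{A. A \<subseteq> C \<and> j \<notin> A \<and> card (M - A) = k}"
    have "card ((M - A) \<union> {j}) = (if j \<in> A then card (M - A) + 1 else card (M - A))" for A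
      using M j by (auto simp: insert_absorb)
    then have "{A. A \<subseteq> C \<and> card ((M - A) \<union> {j}) = k} = ?X \<union> ?Y" by auto
    then have "sum ?f {A. A \<subseteq> C \<and> card ((M - A) \<union> {j}) = k} = sum ?f ?X + sum ?f ?Y"
      using C by (simp only:) (intro sum.union_disjoint, auto)
    also have "sum ?f ?X = (\<Sum>A\<in>?X. w (A - {j}) * real (\<phi> A))"
      by (intro sum.cong refl) auto
    also have "sum ?f ?Y = - (\<Sum>A\<in>?Y. w A * real (\<phi> A))"
      by (subst sum_negf[symmetric], intro sum.cong refl) (simp add: insert_Diff_if)
    finally show "(\<Sum>A\<in>?X. w (A - {j}) * real (\<phi> A)) - (\<Sum>A\<in>?Y. w A * real (\<phi> A)) =
        sum ?f {A. A \<subseteq> C \<and> card ((M - A) \<union> {j}) = k}"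
      by simp
  qed
  have s4: "subsignature P C \<phi> T M k =
      (\<Sum>A | A \<subseteq> C \<and> card (M \<inter> A) = m - k + 1.
         (real m - real k + 1) / (real n * real ((n - 1) choose (card A - 1))) * real (\<phi> A))
    - (\<Sum>A | A \<subseteq> C \<and> card (M \<inter> A) = m - k. real k * w A * real (\<phi> A))"
  proof -
    \<comment> \<open>On sets containing \<open>j\<close>, the weight of \<open>A - {j}\<close> no longer depends on \<open>j\<close>, so that the terms
      can be collected by \<open>A\<close>.\<close>
    let ?v = "\<lambda>A. 1 / (real n * real ((n - 1) choose (card A - 1)))"
    have "(\<Sum>j\<in>M. \<Sum>A | A \<subseteq> C \<and> j \<in> A \<and> card (M - A) + 1 = k. w (A - {j}) * real (\<phi> A)) =
        (\<Sum>j\<in>M. \<Sum>A | A \<subseteq> C \<and> j \<in> A \<and> card (M - A) + 1 = k. ?v A * real (\<phi> A))"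
      by (intro sum.cong refl) (auto simp: w_def)
    also have "\<dots> = (\<Sum>A | A \<subseteq> C \<and> card (M - A) + 1 = k.
        real (card {j\<in>M. j \<in> A}) * (?v A * real (\<phi> A)))"
      by (rule sum_weighted_double_count[OF C M])
    also have "\<dots> = (\<Sum>A | A \<subseteq> C \<and> card (M \<inter> A) = m - k + 1.
        (real m - real k + 1) * (?v A * real (\<phi> A)))"
    proof (intro sum.cong)
      have "card (M - A) + 1 = k \<longleftrightarrow> card (M \<inter> A) = m - k + 1" for A
        using card_diff[of A] k by linarith
      then show "{A. A \<subseteq> C \<and> card (M - A) + 1 = k} = {A. A \<subseteq> C \<and> card (M \<inter> A) = m - k + 1}"
        by auto
    qed (use k in \<open>auto simp: Int_def\<close>)
    finally have pos: "(\<Sum>j\<in>M. \<Sum>A | A \<subseteq> C \<and> j \<in> A \<and> card (M - A) + 1 = k.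
        w (A - {j}) * real (\<phi> A)) = \<dots>" .
    have "(\<Sum>j\<in>M. \<Sum>A | A \<subseteq> C \<and> j \<notin> A \<and> card (M - A) = k. w A * real (\<phi> A)) =
        (\<Sum>A | A \<subseteq> C \<and> card (M - A) = k. real (card {j\<in>M. j \<notin> A}) * (w A * real (\<phi> A)))"
      by (rule sum_weighted_double_count[OF C M])
    also have "\<dots> = (\<Sum>A | A \<subseteq> C \<and> card (M \<inter> A) = m - k. real k * (w A * real (\<phi> A)))"
    proof (intro sum.cong)
      have "card (M - A) = k \<longleftrightarrow> card (M \<inter> A) = m - k" for A
        using card_diff[of A] k by linarith
      then show "{A. A \<subseteq> C \<and> card (M - A) = k} = {A. A \<subseteq> C \<and> card (M \<inter> A) = m - k}"
        by auto
      fix A assume "A \<in> {A. A \<subseteq> C \<and> card (M \<inter> A) = m - k}"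
      then have "card (M - A) = k" using card_diff[of A] k by auto
      then show "real (card {j\<in>M. j \<notin> A}) * (w A * real (\<phi> A)) = real k * (w A * real (\<phi> A))"
        by (simp add: set_diff_eq)
    qed
    finally show ?thesis
      unfolding split sum_subtractf pos by (simp add: mult.assoc)
  qed
  show ?thesis
    using s1 s2 s3 s4 unfolding w_def D_def by simp
qed

end
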